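(* Let $d\ge1$, let $p\in\mathbb R$, and let $f:(0,+\infty)\to\mathbb R$ be any convex function with $f''(x)=x^p$ and $f(1)=0$. Let $\bar f(x)=xf(1/x)$. Let $\rho$ and $\rho^*$ be any positive probability densities on $\mathbb R^d$ such that $f'(\rho/\rho^* )$ is absolutely integrable with respect to $\rho$, and set $$I=-\int\Bigl(-\rho f'\bigl(\tfrac{\rho}{\rho^*}\bigr)+\rho\,\mathbb E_\rho\bigl[f'\bigl(\tfrac{\rho}{\rho^*}\bigr)\bigr]\Bigr)\Bigl(f\bigl(\tfrac{\rho^*}{\rho}\bigr)-\tfrac{\rho^*}{\rho}f'\bigl(\tfrac{\rho^*}{\rho}\bigr)\Bigr)d\theta .$$ If $p\le-2$ or $p\ge-1$, then $$I\ge D_{\bar f}[\rho\Vert\rho^*]+D_f[\rho\Vert\rho^*].$$ If $-2<p<-1$, then $$I\ge\tfrac12\bigl(D_{\bar f}[\rho\Vert\rho^*]+D_f[\rho\Vert\rho^*]\bigr).$$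
   Context: For a convex function $h$ on $(0,+\infty)$ with $h(1)=0$, $D_h[\rho\Vert\rho^*]=\int\rho^*h(\rho/\rho^* )\,d\theta$; in particular $D_{\bar f}[\rho\Vert\rho^*]=\int\rho f(\rho^*/\rho)\,d\theta$. $\mathbb E_\rho[\psi]=\int\rho\,\psi\,d\theta$. All these quantities and $I$ are understood as elements of $(-\infty,+\infty]$. *)

theory Defs
  imports "HOL-Analysis.Analysis"
begin

text \<open>
  Integrals with values in the extended reals. The integral of \<open>h\<close> exists in the extended sense
  if \<open>h\<close> is measurable and its positive part or its negative part has finite integral; only then is
  the value of \<open>ext_integral\<close> meaningful (the type \<open>ereal\<close> sets \<open>\<infinity> - \<infinity> = \<infinity>\<close>).
\<close>

definition ext_integral :: "'a measure \<Rightarrow> ('a \<Rightarrow> real) \<Rightarrow> ereal" where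
  "ext_integral M h =
     enn2ereal (\<integral>\<^sup>+ x. ennreal (h x) \<partial>M) - enn2ereal (\<integral>\<^sup>+ x. ennreal (- h x) \<partial>M)"

definition has_ext_integral :: "'a measure \<Rightarrow> ('a \<Rightarrow> real) \<Rightarrow> bool" where
  "has_ext_integral M h \<longleftrightarrow> h \<in> borel_measurable M \<and>
     ((\<integral>\<^sup>+ x. ennreal (h x) \<partial>M) < \<infinity> \<or> (\<integral>\<^sup>+ x. ennreal (- h x) \<partial>M) < \<infinity>)"

definition positive_density :: "(real ^ 'n \<Rightarrow> real) \<Rightarrow> bool" where
  "positive_density \<rho> \<longleftrightarrow>
     (\<forall>\<theta>. 0 < \<rho> \<theta>) \<and> integrable lebesgue \<rho> \<and> (LINT \<theta>|lebesgue. \<rho> \<theta>) = 1"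

definition expect :: "(real ^ 'n \<Rightarrow> real) \<Rightarrow> (real ^ 'n \<Rightarrow> real) \<Rightarrow> real" where
  "expect \<rho> \<psi> = (LINT \<theta>|lebesgue. \<rho> \<theta> * \<psi> \<theta>)"

text \<open>A function on \<open>(0, \<infinity>)\<close> is a total function of which only the values on \<open>{0<..}\<close> matter.\<close>

definition conj_fun :: "(real \<Rightarrow> real) \<Rightarrow> real \<Rightarrow> real" where
  "conj_fun f x = x * f (1 / x)"

definition divergence_integrand ::
  "(real \<Rightarrow> real) \<Rightarrow> (real ^ 'n \<Rightarrow> real) \<Rightarrow> (real ^ 'n \<Rightarrow> real) \<Rightarrow> real ^ 'n \<Rightarrow> real" where
  "divergence_integrand h \<rho> \<rho>s \<theta> = \<rho>s \<theta> * h (\<rho> \<theta> / \<rho>s \<theta>)"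

definition divergence ::
  "(real \<Rightarrow> real) \<Rightarrow> (real ^ 'n \<Rightarrow> real) \<Rightarrow> (real ^ 'n \<Rightarrow> real) \<Rightarrow> ereal" where
  "divergence h \<rho> \<rho>s = ext_integral lebesgue (divergence_integrand h \<rho> \<rho>s)"

definition I_integrand ::
  "(real \<Rightarrow> real) \<Rightarrow> (real ^ 'n \<Rightarrow> real) \<Rightarrow> (real ^ 'n \<Rightarrow> real) \<Rightarrow> real ^ 'n \<Rightarrow> real" where
  "I_integrand f \<rho> \<rho>s \<theta> =
     (- \<rho> \<theta> * deriv f (\<rho> \<theta> / \<rho>s \<theta>)
        + \<rho> \<theta> * expect \<rho> (\<lambda>\<eta>. deriv f (\<rho> \<eta> / \<rho>s \<eta>)))
     * (f (\<rho>s \<theta> / \<rho> \<theta>) - \<rho>s \<theta> / \<rho> \<theta> * deriv f (\<rho>s \<theta> / \<rho> \<theta>))"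

definition I_functional ::
  "(real \<Rightarrow> real) \<Rightarrow> (real ^ 'n \<Rightarrow> real) \<Rightarrow> (real ^ 'n \<Rightarrow> real) \<Rightarrow> ereal" where
  "I_functional f \<rho> \<rho>s = - ext_integral lebesgue (I_integrand f \<rho> \<rho>s)"

end

theory Submission
  imports Defs
begin

text \<open>
  Adding a multiple of \<open>x - 1\<close> to \<open>f\<close> changes neither side, so let \<open>f' 1 = 0\<close>. With \<open>v = \<rho>s / \<rho>\<close>,
  whose \<open>\<rho>\<close>-mean is \<open>1\<close>, both \<open>A = f' (1 / v)\<close> and \<open>G = f v - v * f' v\<close> are minus Box-Cox
  transforms of \<open>v\<close>, with parameters adding up to \<open>1\<close>. The functional is
  the covariance of \<open>A\<close> and \<open>G\<close> under \<open>\<rho>\<close>, and the sum of the two divergences is the mean of \<open>A * G\<close>.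
  Formally the defect is the product of the means of \<open>A\<close> and \<open>G\<close>. By Jensen these have opposite signs if
  \<open>p \<le> -2\<close> or \<open>p \<ge> -1\<close>; otherwise they are nonnegative and bounded, and the
  product is at most half of the mean of \<open>A * G\<close>. As the integrals may be infinite, the
  estimates are made pointwise: tangent lines at \<open>v = 1\<close> provide integrable error terms of
  nonnegative integral.
\<close>

section \<open>Extended integrals of functions with an integrable lower bound\<close>

text \<open>As \<open>h \<ge> k\<close>, the negative part of \<open>h\<close> has finite integral,
  so \<open>\<infinity> - \<infinity>\<close> cannot occur. Splitting the integrands this way leaves
  only integrals of nonnegative functions to compare, where infinite values do no harm.\<close>

lemma ext_integral_nonneg_add:
  assumes g: "g \<in> borel_measurable M" "\<And>x. 0 \<le> g x"
    and k: "integrable M k"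
    and h: "\<And>x. h x = g x + k x"
  shows "has_ext_integral M h"
    and "ext_integral M h = enn2ereal (\<integral>\<^sup>+ x. ennreal (g x) \<partial>M) + ereal (LINT x|M. k x)"
proof -
  have km: "k \<in> borel_measurable M" using k by simp
  have h_eq: "h = (\<lambda>x. g x + k x)" using h by auto
  have hm: "h \<in> borel_measurable M" using g(1) km by (simp add: h_eq)
  have kneg: "(\<integral>\<^sup>+ x. ennreal (- k x) \<partial>M) < \<infinity>"
    using k by (simp add: real_integrable_def top.not_eq_extremum)
  have "(\<integral>\<^sup>+ x. ennreal (- h x) \<partial>M) \<le> (\<integral>\<^sup>+ x. ennreal (- k x) \<partial>M)"
    using g(2) by (intro nn_integral_mono ennreal_leI) (simp add: h)
  with kneg have hneg: "(\<integral>\<^sup>+ x. ennreal (- h x) \<partial>M) < \<infinity>" by simp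
  show "has_ext_integral M h" using hm hneg by (simp add: has_ext_integral_def)
  show "ext_integral M h = enn2ereal (\<integral>\<^sup>+ x. ennreal (g x) \<partial>M) + ereal (LINT x|M. k x)"
  proof (cases "(\<integral>\<^sup>+ x. ennreal (g x) \<partial>M) = \<infinity>")
    case False
    then have gi: "integrable M g"
      using g by (intro integrableI_nonneg) (auto simp: top.not_eq_extremum)
    have hi: "integrable M h"
      using gi k by (simp add: h_eq)
    have fin: "(\<integral>\<^sup>+ x. ennreal (h x) \<partial>M) < \<infinity>"
      using hi by (simp add: real_integrable_def top.not_eq_extremum)
    have "ext_integral M h = ereal (LINT x|M. h x)"
      unfolding ext_integral_def real_lebesgue_integral_def[OF hi]
      using fin hneg by (auto simp: top_ennreal_def[symmetric] less_top_ennreal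
          enn2ereal_ennreal enn2real_ennreal)
    also have "(LINT x|M. h x) = (LINT x|M. g x) + (LINT x|M. k x)"
      using gi k by (simp add: h)
    finally show ?thesis
      using gi g(2) by (simp add: nn_integral_eq_integral enn2ereal_ennreal)
  next
    case True
    \<comment> \<open>Since \<open>g = h - k\<close>, \<open>g\<close> is at most the positive part
      of \<open>h\<close> plus the negative part of \<open>k\<close>. The latter has finite
      integral, so the infinite value passes to \<open>h\<close>.\<close>
    have "(\<integral>\<^sup>+ x. ennreal (g x) \<partial>M) \<le> (\<integral>\<^sup>+ x. ennreal (h x) + ennreal (- k x) \<partial>M)"
    proof (intro nn_integral_mono)
      fix x
      have "g x = h x + - k x" by (simp add: h)
      then show "ennreal (g x) \<le> ennreal (h x) + ennreal (- k x)"
        by (metis ennreal_leI ennreal_plus ennreal_neg add.right_neutral add.left_neutral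
            add_mono_thms_linordered_semiring(1) g(2) linear order_trans zero_le le_add_same_cancel1 le_add_same_cancel2)
    qed
    also have "\<dots> = (\<integral>\<^sup>+ x. ennreal (h x) \<partial>M) + (\<integral>\<^sup>+ x. ennreal (- k x) \<partial>M)"
      using hm km by (intro nn_integral_add) auto
    finally have "(\<integral>\<^sup>+ x. ennreal (h x) \<partial>M) = \<infinity>"
      using True kneg by (auto simp: top_unique ennreal_add_eq_top)
    then show ?thesis using True hneg unfolding ext_integral_def
      by (auto simp: less_top_ennreal enn2ereal_ennreal)
  qed
qed

text \<open>As \<open>\<infinity> - \<infinity> = \<infinity>\<close> in \<open>ereal\<close>,
  pulling out the sign relies on one of the two parts being finite.\<close>

lemma ext_integral_uminus:
  assumes "has_ext_integral M h"
  shows "has_ext_integral M (\<lambda>x. - h x)" and "ext_integral M (\<lambda>x. - h x) = - ext_integral M h"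
proof -
  show "has_ext_integral M (\<lambda>x. - h x)" using assms by (auto simp: has_ext_integral_def)
  show "ext_integral M (\<lambda>x. - h x) = - ext_integral M h"
    using assms unfolding has_ext_integral_def ext_integral_def
    by (subst ereal_minus_diff_eq) (auto simp: enn2ereal_eq_top_iff)
qed

section \<open>Box-Cox transforms and their tangent lines at 1\<close>

text \<open>On the positive reals this is the primitive of \<open>x powr (q - 1)\<close> that
  vanishes at 1; the logarithm is the limit as \<open>q\<close> tends to 0. Hence \<open>f'\<close>
  is \<open>box_cox (p + 1)\<close> up to a constant.\<close>

definition box_cox :: "real \<Rightarrow> real \<Rightarrow> real" where
  "box_cox q x = (if q = 0 then ln x else (x powr q - 1) / q)"

lemma box_cox_one [simp]: "box_cox q 1 = 0"
  by (simp add: box_cox_def)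

lemma measurable_box_cox [measurable]: "box_cox q \<in> borel_measurable borel"
  unfolding box_cox_def by (cases "q = 0") simp_all

lemma has_real_derivative_box_cox:
  assumes "0 < x"
  shows "(box_cox q has_real_derivative x powr (q - 1)) (at x)"
proof (cases "q = 0")
  case True
  then have "box_cox q = ln" by (auto simp: box_cox_def)
  then show ?thesis using assms True
    by (auto intro!: derivative_eq_intros simp: powr_minus inverse_eq_divide)
next
  case False
  then have "box_cox q = (\<lambda>x. (x powr q - 1) / q)" by (auto simp: box_cox_def)
  then show ?thesis using assms False
    by (auto intro!: derivative_eq_intros simp: has_real_derivative_powr)
qed

lemma box_cox_inverse:
  assumes "0 < x"
  shows "box_cox q (1 / x) = - box_cox (- q) x"
  using assms by (auto simp: box_cox_def ln_div powr_divide powr_minus field_simps)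

text \<open>Mean value theorem between 1 and \<open>x\<close>. Knowing on which side of 1 the point
  \<open>\<xi>\<close> lies suffices to compare \<open>\<xi> powr (q - 1)\<close> with 1.\<close>

lemma box_cox_mean_value:
  assumes "0 < x"
  obtains \<xi> where "0 < \<xi>" "x \<ge> 1 \<Longrightarrow> \<xi> \<ge> 1" "x \<le> 1 \<Longrightarrow> \<xi> \<le> 1"
    "box_cox q x = (x - 1) * \<xi> powr (q - 1)"
proof (cases x "1::real" rule: linorder_cases)
  case less
  then obtain \<xi> where "x < \<xi>" "\<xi> < 1" "box_cox q 1 - box_cox q x = (1 - x) * \<xi> powr (q - 1)"
    using MVT2[of x 1 "box_cox q" "\<lambda>x. x powr (q - 1)"] has_real_derivative_box_cox assms
    by (metis less_le_trans)
  then show thesis using less assms by (intro that[of \<xi>]) (auto simp: algebra_simps)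
next
  case equal
  then show thesis by (intro that[of 1]) auto
next
  case greater
  then obtain \<xi> where "1 < \<xi>" "\<xi> < x" "box_cox q x - box_cox q 1 = (x - 1) * \<xi> powr (q - 1)"
    using MVT2[of 1 x "box_cox q" "\<lambda>x. x powr (q - 1)"] has_real_derivative_box_cox assms
    by (metis less_le_trans zero_less_one)
  then show thesis using greater by (intro that[of \<xi>]) auto
qed

text \<open>For \<open>q \<le> 1\<close> the transform is concave, so it stays below its tangent at
  1; convexity gives the reverse bound for \<open>1 \<le> q\<close> in the next lemma.\<close>

lemma box_cox_le:
  assumes "0 < x" "q \<le> 1"
  shows "box_cox q x \<le> x - 1"
proof -
  obtain \<xi> where \<xi>: "0 < \<xi>" "x \<ge> 1 \<Longrightarrow> \<xi> \<ge> 1" "x \<le> 1 \<Longrightarrow> \<xi> \<le> 1"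
    "box_cox q x = (x - 1) * \<xi> powr (q - 1)"
    using box_cox_mean_value assms(1) by blast
  show ?thesis
  proof (cases "x \<ge> 1")
    case True
    then have "\<xi> powr (q - 1) \<le> 1" using \<xi>(2) assms powr_mono[of "q - 1" 0 \<xi>] by simp
    then show ?thesis using True \<xi>(4) by (simp add: mult_left_le)
  next
    case False
    then have "\<xi> powr (q - 1) \<ge> 1"
      using \<xi> assms powr_mono'[of "q - 1" 0 \<xi>] by simp
    then show ?thesis using False \<xi>(4) mult_left_mono_neg[of 1 "\<xi> powr (q - 1)" "x - 1"] by simp
  qed
qed

lemma box_cox_ge:
  assumes "0 < x" "1 \<le> q"
  shows "x - 1 \<le> box_cox q x"
proof -
  obtain \<xi> where \<xi>: "0 < \<xi>" "x \<ge> 1 \<Longrightarrow> \<xi> \<ge> 1" "x \<le> 1 \<Longrightarrow> \<xi> \<le> 1"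
    "box_cox q x = (x - 1) * \<xi> powr (q - 1)"
    using box_cox_mean_value assms(1) by blast
  show ?thesis
  proof (cases "x \<ge> 1")
    case True
    then have "\<xi> powr (q - 1) \<ge> 1" using \<xi>(2) assms powr_mono[of 0 "q - 1" \<xi>] by simp
    then show ?thesis using True \<xi>(4) mult_left_mono[of 1 "\<xi> powr (q - 1)" "x - 1"] by simp
  next
    case False
    then have "\<xi> powr (q - 1) \<le> 1"
      using \<xi> assms powr_mono'[of 0 "q - 1" \<xi>] by simp
    then show ?thesis using False \<xi>(4) mult_left_mono_neg[of "\<xi> powr (q - 1)" 1 "x - 1"] by simp
  qed
qed

text \<open>Powers are nonnegative. For \<open>0 < q < 1\<close> this supplies the lower bound that
  the tangent line cannot.\<close>

lemma box_cox_ge_bound: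
  assumes "0 < q"
  shows "- (1 / q) \<le> box_cox q x"
  using assms by (simp add: box_cox_def field_simps)

text \<open>The two powers multiply to \<open>x\<close>, so the product is linear in its factors up
  to a multiple of \<open>x - 1\<close>, which will have mean zero.\<close>

lemma box_cox_mult:
  assumes "q + s = 1" "0 < x" "q \<noteq> 0" "s \<noteq> 0"
  shows "box_cox q x * box_cox s x = - box_cox q x / s - box_cox s x / q + (x - 1) / (q * s)"
proof -
  have "x powr q * x powr s = x" using assms by (simp flip: powr_add)
  then show ?thesis using assms by (simp add: box_cox_def divide_simps) (simp add: algebra_simps)
qed

section \<open>The function \<open>f\<close> normalised by \<open>f' 1 = 0\<close>\<close>

text \<open>Integration by parts gives this primitive of \<open>box_cox q\<close> vanishing at 1, in
  a form valid for every \<open>q\<close>, including the logarithmic cases.\<close>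

definition box_cox_primitive :: "real \<Rightarrow> real \<Rightarrow> real" where
  "box_cox_primitive q x = x * box_cox q x - box_cox (q + 1) x"

lemma measurable_box_cox_primitive [measurable]: "box_cox_primitive q \<in> borel_measurable borel"
  unfolding box_cox_primitive_def by simp

lemma has_real_derivative_box_cox_primitive:
  assumes "0 < x"
  shows "(box_cox_primitive q has_real_derivative box_cox q x) (at x)"
proof -
  have "((\<lambda>x. x * box_cox q x - box_cox (q + 1) x) has_real_derivative box_cox q x) (at x)"
    using assms
    by (auto intro!: derivative_eq_intros has_real_derivative_box_cox simp: powr_diff)
  then show ?thesis by (simp add: box_cox_primitive_def[abs_def])
qed

text \<open>The integrands of both divergences add up to the product of the two factors
  whose covariance is \<open>I\<close>.\<close>

lemma box_cox_primitive_symmetrized: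
  assumes "0 < x"
  shows "box_cox_primitive q x + x * box_cox_primitive q (1 / x)
    = box_cox (- q) x * box_cox (q + 1) x"
proof -
  have pw: "x powr (q + 1) = x * x powr q" "x powr (- q - 1) = 1 / (x * x powr q)"
    "x powr (- q) = 1 / x powr q"
    using assms by (simp_all add: powr_add powr_minus powr_diff field_simps)
  have pos: "x powr q > 0" using assms by simp
  \<comment> \<open>Logarithms appear exactly when \<open>q\<close> or \<open>q + 1\<close>
    vanishes.\<close>
  consider "q = 0" | "q = -1" | "q \<noteq> 0" "q \<noteq> -1" by blast
  then show ?thesis
  proof cases
    case 1
    then show ?thesis using assms
      by (simp add: box_cox_primitive_def box_cox_inverse) (simp add: box_cox_def field_simps)
  next
    case 2
    then show ?thesis using assms
      by (simp add: box_cox_primitive_def box_cox_inverse)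
        (simp add: box_cox_def powr_minus field_simps)
  next
    case 3
    then have "q + 1 \<noteq> 0" by linarith
    then show ?thesis using assms pos 3
      by (simp add: box_cox_primitive_def box_cox_inverse)
        (simp add: box_cox_def pw divide_simps, simp add: algebra_simps)
  qed
qed


section \<open>Pointwise lower bound for the covariance integrand\<close>

text \<open>Only the first factor is known to be integrable, so the product of means cannot be split
  off. Instead \<open>(1 - c) * B * B' - \<beta> * B'\<close> gets an integrable minorant whose
  integral is nonnegative.\<close>

lemma covariance_integrand_lower_bound:
  fixes M :: "'a measure" and \<rho> \<rho>s :: "'a \<Rightarrow> real" and q :: real
  assumes pos: "\<And>x. 0 < \<rho> x" "\<And>x. 0 < \<rho>s x"
    and int: "integrable M \<rho>" "integrable M \<rho>s" "(LINT x|M. \<rho> x) = 1" "(LINT x|M. \<rho>s x) = 1"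
    and intB: "integrable M (\<lambda>x. \<rho> x * box_cox (- q) (\<rho>s x / \<rho> x))"
  defines "\<beta> \<equiv> LINT x|M. \<rho> x * box_cox (- q) (\<rho>s x / \<rho> x)"
    and "c \<equiv> if - 1 < q \<and> q < 0 then 1 / 2 else 1"
  obtains k where "integrable M k" "0 \<le> (LINT x|M. k x)"
    "\<And>x. c * (\<rho> x * (box_cox (- q) (\<rho>s x / \<rho> x) * box_cox (q + 1) (\<rho>s x / \<rho> x))) + k x
      \<le> \<rho> x * ((box_cox (- q) (\<rho>s x / \<rho> x) - \<beta>) * box_cox (q + 1) (\<rho>s x / \<rho> x))"
proof -
  define v where "v x = \<rho>s x / \<rho> x" for x
  define B where "B x = box_cox (- q) (v x)" for x
  define B' where "B' x = box_cox (q + 1) (v x)" for x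
  have v: "0 < v x" for x using pos by (simp add: v_def)
  have \<rho>v: "\<rho> x * v x = \<rho>s x" for x using pos(1)[of x] by (simp add: v_def)
  have intB: "integrable M (\<lambda>x. \<rho> x * B x)" and \<beta>: "\<beta> = (LINT x|M. \<rho> x * B x)"
    using intB by (simp_all add: \<beta>_def B_def v_def)
  have intv: "integrable M (\<lambda>x. \<rho> x * (v x - 1))" and intv0: "(LINT x|M. \<rho> x * (v x - 1)) = 0"
    using int by (simp_all add: algebra_simps \<rho>v)
  \<comment> \<open>Jensen's inequality via the tangent line at the mean 1 of \<open>v\<close>, for
    concave \<open>B\<close> here and convex \<open>B\<close> below.\<close>
  have \<beta>_le: "\<beta> \<le> 0" if "- q \<le> 1"
  proof -
    have "\<beta> \<le> (LINT x|M. \<rho> x * (v x - 1))" unfolding \<beta>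
      using intB intv by (rule integral_mono)
        (auto intro!: mult_left_mono box_cox_le v that less_imp_le[OF pos(1)] simp: B_def)
    then show ?thesis by (simp add: intv0)
  qed
  have \<beta>_ge: "0 \<le> \<beta>" if "1 \<le> - q"
  proof -
    have "(LINT x|M. \<rho> x * (v x - 1)) \<le> \<beta>" unfolding \<beta>
      using intv intB by (rule integral_mono)
        (auto intro!: mult_left_mono box_cox_ge v that less_imp_le[OF pos(1)] simp: B_def)
    then show ?thesis by (simp add: intv0)
  qed
  note result = that
  have *: thesis if k: "integrable M (\<lambda>x. \<rho> x * k x)" "0 \<le> (LINT x|M. \<rho> x * k x)"
    and le: "\<And>x. c * (B x * B' x) + k x \<le> (B x - \<beta>) * B' x" for k
  proof (rule result[OF k])
    fix x
    have "\<rho> x * (c * (B x * B' x) + k x) \<le> \<rho> x * ((B x - \<beta>) * B' x)"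
      by (intro mult_left_mono le less_imp_le pos)
    then show "c * (\<rho> x * (box_cox (- q) (\<rho>s x / \<rho> x) * box_cox (q + 1) (\<rho>s x / \<rho> x))) + \<rho> x * k x
      \<le> \<rho> x * ((box_cox (- q) (\<rho>s x / \<rho> x) - \<beta>) * box_cox (q + 1) (\<rho>s x / \<rho> x))"
      by (simp add: B_def B'_def v_def algebra_simps)
  qed
  show thesis
  proof (cases "- 1 < q \<and> q < 0")
    case False
    \<comment> \<open>With \<open>c = 1\<close> only \<open>- \<beta> * B'\<close> remains. The sign
      of \<open>\<beta>\<close> and the side of the tangent on which \<open>B'\<close> lies switch
      together, so one minorant, of mean zero, serves both cases.\<close>
    have le: "\<beta> * B' x \<le> \<beta> * (v x - 1)" for x
    proof (cases "q \<ge> 0")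
      case True
      then show ?thesis using \<beta>_le box_cox_ge[OF v, of "q + 1" x]
        by (intro mult_left_mono_neg) (auto simp: B'_def)
    next
      case False': False
      then have "q \<le> - 1" using False by auto
      then show ?thesis using \<beta>_ge box_cox_le[OF v, of "q + 1" x]
        by (intro mult_left_mono) (auto simp: B'_def)
    qed
    have eq: "\<rho> x * (- \<beta> * (v x - 1)) = - \<beta> * (\<rho> x * (v x - 1))" for x by simp
    show thesis
    proof (rule *[of "\<lambda>x. - \<beta> * (v x - 1)"])
      show "integrable M (\<lambda>x. \<rho> x * (- \<beta> * (v x - 1)))"
        unfolding eq using intv by (intro integrable_mult_right) auto
      show "0 \<le> (LINT x|M. \<rho> x * (- \<beta> * (v x - 1)))"
        unfolding eq by (subst integral_mult_right_zero) (simp add: intv0)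
      show "c * (B x * B' x) + - \<beta> * (v x - 1) \<le> (B x - \<beta>) * B' x" for x
        using le[of x] False by (auto simp: c_def algebra_simps)
    qed
  next
    case True
    define s t where "s = q + 1" and "t = - q"
    have st: "0 < s" "0 < t" "t + s = 1" using True by (auto simp: s_def t_def)
    have c: "c = 1 / 2" using True by (simp add: c_def)
    \<comment> \<open>By this identity the remainder \<open>B * B' / 2 - \<beta> * B'\<close>
      contains \<open>B'\<close> only with coefficient \<open>- (1 / (2 * t) + \<beta>)\<close>, and
      all its other terms are integrable.\<close>
    have BB': "B x * B' x = - B x / s - B' x / t + (v x - 1) / (t * s)" for x
      using box_cox_mult[of t s "v x"] st v by (simp add: B_def B'_def s_def t_def)
    have "\<beta> \<le> 0" using \<beta>_le True by simp
    have "(LINT x|M. - (1 / t) * \<rho> x) \<le> \<beta>" unfolding \<beta>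
    proof (rule integral_mono)
      show "- (1 / t) * \<rho> x \<le> \<rho> x * B x" for x
        using mult_left_mono[OF box_cox_ge_bound[OF st(2)] less_imp_le[OF pos(1)], of x "v x"]
        by (simp add: B_def t_def mult.commute)
    qed (use int intB in auto)
    then have "- (1 / t) \<le> \<beta>" using int by simp
    show thesis
    \<comment> \<open>If this quantity is nonnegative, \<open>B'\<close> is replaced by its upper
      bound \<open>v - 1\<close>, and the minorant has mean \<open>- \<beta> / (2 * s)\<close>.
      Otherwise \<open>B'\<close> is replaced by its lower bound \<open>- (1 / s)\<close>, and the
      mean is \<open>(1 / t + \<beta>) / (2 * s)\<close>.\<close>
    proof (cases "0 \<le> 1 / (2 * t) + \<beta>")
      case pos': True
      have eq: "\<rho> x * (- B x / (2 * s) + (v x - 1) / (2 * t * s) - (1 / (2 * t) + \<beta>) * (v x - 1))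
        = - 1 / (2 * s) * (\<rho> x * B x)
          + (1 / (2 * t * s) - (1 / (2 * t) + \<beta>)) * (\<rho> x * (v x - 1))" for x
        by (simp add: algebra_simps add_divide_distrib diff_divide_distrib)
      have i: "integrable M (\<lambda>x. - 1 / (2 * s) * (\<rho> x * B x))"
        "integrable M (\<lambda>x. (1 / (2 * t * s) - (1 / (2 * t) + \<beta>)) * (\<rho> x * (v x - 1)))"
        using intB intv by (intro integrable_mult_right, simp)+
      show thesis
      proof (rule *[of "\<lambda>x. - B x / (2 * s) + (v x - 1) / (2 * t * s)
          - (1 / (2 * t) + \<beta>) * (v x - 1)"])
        show "integrable M (\<lambda>x. \<rho> x * (- B x / (2 * s) + (v x - 1) / (2 * t * s)
            - (1 / (2 * t) + \<beta>) * (v x - 1)))"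
          unfolding eq by (intro Bochner_Integration.integrable_add i)
        have "(LINT x|M. \<rho> x * (- B x / (2 * s) + (v x - 1) / (2 * t * s)
            - (1 / (2 * t) + \<beta>) * (v x - 1))) = - 1 / (2 * s) * \<beta>"
          unfolding eq
          by (simp only: Bochner_Integration.integral_add[OF i] integral_mult_right_zero
              intv0 \<beta>[symmetric])
        then show "0 \<le> (LINT x|M. \<rho> x * (- B x / (2 * s) + (v x - 1) / (2 * t * s)
            - (1 / (2 * t) + \<beta>) * (v x - 1)))"
          using \<open>\<beta> \<le> 0\<close> st by (simp add: divide_nonpos_pos)
        fix x
        have "B' x \<le> v x - 1" unfolding B'_def using True by (intro box_cox_le v) simp
        then have "(1 / (2 * t) + \<beta>) * B' x \<le> (1 / (2 * t) + \<beta>) * (v x - 1)"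
          using pos' by (intro mult_left_mono)
        then show "c * (B x * B' x) + (- B x / (2 * s) + (v x - 1) / (2 * t * s)
            - (1 / (2 * t) + \<beta>) * (v x - 1)) \<le> (B x - \<beta>) * B' x"
          unfolding c using BB'[of x] by (simp add: algebra_simps)
      qed
    next
      case neg: False
      have eq: "\<rho> x * (- B x / (2 * s) + (v x - 1) / (2 * t * s) + (1 / (2 * t) + \<beta>) / s)
        = - 1 / (2 * s) * (\<rho> x * B x) + 1 / (2 * t * s) * (\<rho> x * (v x - 1))
          + (1 / (2 * t) + \<beta>) / s * \<rho> x" for x
        by (simp add: algebra_simps)
      have i: "integrable M (\<lambda>x. - 1 / (2 * s) * (\<rho> x * B x))"
        "integrable M (\<lambda>x. 1 / (2 * t * s) * (\<rho> x * (v x - 1)))"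
        "integrable M (\<lambda>x. (1 / (2 * t) + \<beta>) / s * \<rho> x)"
        using intB intv int by (intro integrable_mult_right, simp)+
      show thesis
      proof (rule *[of "\<lambda>x. - B x / (2 * s) + (v x - 1) / (2 * t * s) + (1 / (2 * t) + \<beta>) / s"])
        show "integrable M (\<lambda>x. \<rho> x * (- B x / (2 * s) + (v x - 1) / (2 * t * s)
            + (1 / (2 * t) + \<beta>) / s))"
          unfolding eq by (intro Bochner_Integration.integrable_add i)
        have "(LINT x|M. \<rho> x * (- B x / (2 * s) + (v x - 1) / (2 * t * s)
            + (1 / (2 * t) + \<beta>) / s)) = - 1 / (2 * s) * \<beta> + (1 / (2 * t) + \<beta>) / s"
          unfolding eq
          by (simp only: Bochner_Integration.integral_add[OF Bochner_Integration.integrable_add[OF i(1,2)] i(3)]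
              Bochner_Integration.integral_add[OF i(1,2)] integral_mult_right_zero intv0 int \<beta>[symmetric])
        also have "\<dots> = (1 / t + \<beta>) / (2 * s)" using st by (simp add: field_simps)
        also have "\<dots> \<ge> 0" using \<open>- (1 / t) \<le> \<beta>\<close> st by simp
        finally show "0 \<le> (LINT x|M. \<rho> x * (- B x / (2 * s) + (v x - 1) / (2 * t * s)
            + (1 / (2 * t) + \<beta>) / s))" .
        fix x
        have "- (1 / s) \<le> B' x" unfolding B'_def using st(1) box_cox_ge_bound by (simp add: s_def)
        then have "(1 / (2 * t) + \<beta>) * B' x \<le> (1 / (2 * t) + \<beta>) * - (1 / s)"
          using neg by (intro mult_left_mono_neg) auto
        then show "c * (B x * B' x) + (- B x / (2 * s) + (v x - 1) / (2 * t * s)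
            + (1 / (2 * t) + \<beta>) / s) \<le> (B x - \<beta>) * B' x"
          unfolding c using BB'[of x] by (simp add: algebra_simps add_divide_distrib)
      qed
    qed
  qed
qed

section \<open>Recovering \<open>f\<close> from its second derivative\<close>

lemma eq_if_deriv_eq_on_positive:
  fixes f g :: "real \<Rightarrow> real"
  assumes "\<And>x. 0 < x \<Longrightarrow> (f has_real_derivative h x) (at x)"
    and "\<And>x. 0 < x \<Longrightarrow> (g has_real_derivative h x) (at x)"
    and "f 1 = g 1" "0 < x"
  shows "f x = g x"
proof -
  have "\<exists>c. \<forall>x\<in>{0<..}. f x - g x = c"
  proof (rule has_field_derivative_zero_constant)
    fix x :: real assume "x \<in> {0<..}"
    then have "((\<lambda>x. f x - g x) has_real_derivative h x - h x) (at x)"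
      using assms(1,2) by (intro DERIV_diff) auto
    then show "((\<lambda>x. f x - g x) has_real_derivative 0) (at x within {0<..})"
      by (simp add: has_field_derivative_at_within)
  qed simp
  then obtain c where "\<And>x. 0 < x \<Longrightarrow> f x - g x = c" by auto
  from this[of 1] this[of x] assms(3,4) show ?thesis by simp
qed

text \<open>Integrating twice from 1 leaves \<open>deriv f 1\<close> as the only free constant,
  because \<open>f 1 = 0\<close>.\<close>

lemma power_second_derivative_form:
  fixes f :: "real \<Rightarrow> real"
  assumes diff_f: "\<And>x. 0 < x \<Longrightarrow> f differentiable (at x)"
    and second_deriv_f: "\<And>x. 0 < x \<Longrightarrow> (deriv f has_real_derivative x powr p) (at x)"
    and f_one: "f 1 = 0" and x: "0 < x"
  shows "deriv f x = deriv f 1 + box_cox (p + 1) x"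
    and "f x = deriv f 1 * (x - 1) + box_cox_primitive (p + 1) x"
proof -
  have deriv: "deriv f x = deriv f 1 + box_cox (p + 1) x" if "0 < x" for x
  proof (rule eq_if_deriv_eq_on_positive[OF _ _ _ that])
    show "(deriv f has_real_derivative x powr p) (at x)" if "0 < x" for x
      using second_deriv_f[OF that] .
    show "((\<lambda>x. deriv f 1 + box_cox (p + 1) x) has_real_derivative x powr p) (at x)"
      if "0 < x" for x
      using that by (auto intro!: derivative_eq_intros has_real_derivative_box_cox)
  qed simp
  show "deriv f x = deriv f 1 + box_cox (p + 1) x" using deriv x .
  show "f x = deriv f 1 * (x - 1) + box_cox_primitive (p + 1) x"
  proof (rule eq_if_deriv_eq_on_positive[OF _ _ _ x])
    show "(f has_real_derivative deriv f x) (at x)" if "0 < x" for x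
      using diff_f[OF that] by (simp add: DERIV_deriv_iff_real_differentiable)
    show "((\<lambda>x. deriv f 1 * (x - 1) + box_cox_primitive (p + 1) x)
        has_real_derivative deriv f x) (at x)" if "0 < x" for x
      using that unfolding deriv[OF that]
      by (auto intro!: derivative_eq_intros has_real_derivative_box_cox_primitive)
  qed (simp add: f_one box_cox_primitive_def)
qed

section \<open>Splitting the integrands and comparing their integrals\<close>

theorem theorem5p6:
  fixes p :: real
    and f :: "real \<Rightarrow> real"
    and \<rho> \<rho>s :: "real ^ 'n \<Rightarrow> real"
  assumes convex_f: "convex_on {0<..} f"
    and diff_f: "\<And>x. 0 < x \<Longrightarrow> f differentiable (at x)"
    and second_deriv_f: "\<And>x. 0 < x \<Longrightarrow> (deriv f has_real_derivative x powr p) (at x)"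
    and f_one: "f 1 = 0"
    and dens: "positive_density \<rho>" "positive_density \<rho>s"
    and integ: "integrable lebesgue (\<lambda>\<theta>. \<rho> \<theta> * deriv f (\<rho> \<theta> / \<rho>s \<theta>))"
  shows "has_ext_integral lebesgue (I_integrand f \<rho> \<rho>s) \<and> -\<infinity> < I_functional f \<rho> \<rho>s \<and>
    has_ext_integral lebesgue (divergence_integrand f \<rho> \<rho>s) \<and> -\<infinity> < divergence f \<rho> \<rho>s \<and>
    has_ext_integral lebesgue (divergence_integrand (conj_fun f) \<rho> \<rho>s) \<and>
      -\<infinity> < divergence (conj_fun f) \<rho> \<rho>s \<and>
    (p \<le> -2 \<or> p \<ge> -1 \<longrightarrow>
       I_functional f \<rho> \<rho>s \<ge> divergence (conj_fun f) \<rho> \<rho>s + divergence f \<rho> \<rho>s) \<and>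
    (-2 < p \<and> p < -1 \<longrightarrow>
       I_functional f \<rho> \<rho>s \<ge>
         ereal (1 / 2) * (divergence (conj_fun f) \<rho> \<rho>s + divergence f \<rho> \<rho>s))"
proof -
  define b where "b = deriv f 1"
  define q where "q = p + 1"
  define B where "B \<theta> = box_cox (- q) (\<rho>s \<theta> / \<rho> \<theta>)" for \<theta>
  define B' where "B' \<theta> = box_cox (q + 1) (\<rho>s \<theta> / \<rho> \<theta>)" for \<theta>
  define \<beta> where "\<beta> = (LINT \<theta>|lebesgue. \<rho> \<theta> * B \<theta>)"
  define g1 where "g1 \<theta> = \<rho>s \<theta> * box_cox_primitive q (\<rho> \<theta> / \<rho>s \<theta>)" for \<theta>
  define g2 where "g2 \<theta> = \<rho> \<theta> * box_cox_primitive q (\<rho>s \<theta> / \<rho> \<theta>)" for \<theta>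
  define N1 where "N1 = enn2ereal (\<integral>\<^sup>+ \<theta>. ennreal (g1 \<theta>) \<partial>lebesgue)"
  define N2 where "N2 = enn2ereal (\<integral>\<^sup>+ \<theta>. ennreal (g2 \<theta>) \<partial>lebesgue)"
  have pos: "\<And>\<theta>. 0 < \<rho> \<theta>" "\<And>\<theta>. 0 < \<rho>s \<theta>"
    and int: "integrable lebesgue \<rho>" "integrable lebesgue \<rho>s"
      "(LINT \<theta>|lebesgue. \<rho> \<theta>) = 1" "(LINT \<theta>|lebesgue. \<rho>s \<theta>) = 1"
    using dens by (auto simp: positive_density_def)
  have [measurable]: "\<rho> \<in> borel_measurable lebesgue" "\<rho>s \<in> borel_measurable lebesgue"
    using int by auto
  have form: "deriv f x = b + box_cox q x" "f x = b * (x - 1) + box_cox_primitive q x"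
    if "0 < x" for x
    unfolding b_def q_def
    by (intro power_second_derivative_form diff_f second_deriv_f f_one that; assumption)+
  \<comment> \<open>The primitive is \<open>f\<close> minus its tangent at 1, so convexity of
    \<open>f\<close> makes it nonnegative.\<close>
  have prim_nonneg: "0 \<le> box_cox_primitive q x" if "0 < x" for x
  proof -
    have "deriv f 1 * (x - 1) \<le> f x - f 1"
    proof (rule convex_on_imp_above_tangent[OF convex_f])
      show "(f has_real_derivative deriv f 1) (at 1 within {0<..})"
        using diff_f[of 1]
        by (simp add: DERIV_deriv_iff_real_differentiable has_field_derivative_at_within)
    qed (use that in \<open>auto simp: interior_open connected_Ioi\<close>)
    then show ?thesis using form(2)[OF that] f_one by (simp add: b_def)
  qed
  have g_nonneg: "0 \<le> g1 \<theta>" "0 \<le> g2 \<theta>" for \<theta>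
    using pos[of \<theta>] by (simp_all add: g1_def g2_def prim_nonneg)
  have g_meas [measurable]: "g1 \<in> borel_measurable lebesgue" "g2 \<in> borel_measurable lebesgue"
    unfolding g1_def g2_def by measurable
  have g_sum: "g1 \<theta> + g2 \<theta> = \<rho> \<theta> * (B \<theta> * B' \<theta>)" for \<theta>
    using box_cox_primitive_symmetrized[of "\<rho>s \<theta> / \<rho> \<theta>" q, symmetric] pos[of \<theta>]
    by (simp add: g1_def g2_def B_def B'_def field_simps)
  have deriv_ratio: "deriv f (\<rho> \<theta> / \<rho>s \<theta>) = b - B \<theta>" for \<theta>
    using form(1)[of "\<rho> \<theta> / \<rho>s \<theta>"] box_cox_inverse[of "\<rho>s \<theta> / \<rho> \<theta>" q] pos[of \<theta>]
    by (simp add: B_def)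
  have intB: "integrable lebesgue (\<lambda>\<theta>. \<rho> \<theta> * B \<theta>)"
    using Bochner_Integration.integrable_diff[OF integrable_mult_right[OF int(1), of b] integ]
    by (simp add: deriv_ratio algebra_simps)
  have expect: "expect \<rho> (\<lambda>\<eta>. deriv f (\<rho> \<eta> / \<rho>s \<eta>)) = b - \<beta>"
    using intB int unfolding expect_def deriv_ratio \<beta>_def by (simp add: right_diff_distrib)

  \<comment> \<open>The linear part \<open>b * (x - 1)\<close> of \<open>f\<close> turns into a
    multiple of the difference of two probability densities, which integrates to zero.\<close>
  have D1: "divergence_integrand f \<rho> \<rho>s \<theta> = g1 \<theta> + b * (\<rho> \<theta> - \<rho>s \<theta>)" for \<theta>
    using pos[of \<theta>] by (simp add: divergence_integrand_def form g1_def field_simps)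
  have D2: "divergence_integrand (conj_fun f) \<rho> \<rho>s \<theta> = g2 \<theta> + b * (\<rho>s \<theta> - \<rho> \<theta>)" for \<theta>
    using pos[of \<theta>]
    by (simp add: divergence_integrand_def conj_fun_def form g2_def field_simps)
  have i1: "integrable lebesgue (\<lambda>\<theta>. b * (\<rho> \<theta> - \<rho>s \<theta>))" "(LINT \<theta>|lebesgue. b * (\<rho> \<theta> - \<rho>s \<theta>)) = 0"
    and i2: "integrable lebesgue (\<lambda>\<theta>. b * (\<rho>s \<theta> - \<rho> \<theta>))" "(LINT \<theta>|lebesgue. b * (\<rho>s \<theta> - \<rho> \<theta>)) = 0"
    using int by simp_all
  note E1 = ext_integral_nonneg_add[OF g_meas(1) g_nonneg(1) i1(1) D1]
  note E2 = ext_integral_nonneg_add[OF g_meas(2) g_nonneg(2) i2(1) D2]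
  have div1: "divergence f \<rho> \<rho>s = N1"
    using E1(2) unfolding i1(2) by (simp add: divergence_def N1_def flip: zero_ereal_def)
  have div2: "divergence (conj_fun f) \<rho> \<rho>s = N2"
    using E2(2) unfolding i2(2) by (simp add: divergence_def N2_def flip: zero_ereal_def)
  have N_nonneg: "0 \<le> N1" "0 \<le> N2" by (simp_all add: N1_def N2_def)

  \<comment> \<open>As \<open>q = p + 1\<close>, the factor one half is used exactly for
    \<open>-2 < p < -1\<close>.\<close>
  define c :: real where "c = (if - 1 < q \<and> q < 0 then 1 / 2 else 1)"
  have "0 \<le> c" by (simp add: c_def)
  obtain k where k: "integrable lebesgue k" "0 \<le> (LINT \<theta>|lebesgue. k \<theta>)"
    "\<And>\<theta>. c * (\<rho> \<theta> * (B \<theta> * B' \<theta>)) + k \<theta> \<le> \<rho> \<theta> * ((B \<theta> - \<beta>) * B' \<theta>)"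
    using covariance_integrand_lower_bound[OF pos int, of q] intB
    unfolding B_def B'_def \<beta>_def c_def by blast
  \<comment> \<open>Removing \<open>k\<close> leaves a function above
    \<open>c * (g1 + g2) \<ge> 0\<close>, so monotonicity of the nonnegative integral applies even
    if the values are infinite.\<close>
  define w where "w \<theta> = \<rho> \<theta> * ((B \<theta> - \<beta>) * B' \<theta>) - k \<theta>" for \<theta>
  have w_ge: "c * (g1 \<theta> + g2 \<theta>) \<le> w \<theta>" for \<theta>
    using k(3)[of \<theta>] by (simp add: w_def g_sum)
  have w_nonneg: "0 \<le> w \<theta>" for \<theta>
    using w_ge[of \<theta>] g_nonneg[of \<theta>] \<open>0 \<le> c\<close> by (meson add_nonneg_nonneg mult_nonneg_nonneg order_trans)
  have [measurable]: "k \<in> borel_measurable lebesgue" using k(1) by simp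
  have w_meas: "w \<in> borel_measurable lebesgue"
    unfolding w_def B_def B'_def by measurable
  \<comment> \<open>Since the second factor of the integrand is \<open>- b - B'\<close>, the
    constant \<open>b\<close> contributes \<open>b * \<rho> * (B - \<beta>)\<close>. This has
    integral zero because \<open>\<beta>\<close> is the mean of \<open>B\<close>.\<close>
  define k' where "k' \<theta> = k \<theta> + b * (\<rho> \<theta> * B \<theta> - \<beta> * \<rho> \<theta>)" for \<theta>
  have k': "integrable lebesgue k'" "(LINT \<theta>|lebesgue. k' \<theta>) = (LINT \<theta>|lebesgue. k \<theta>)"
    unfolding k'_def using k(1) intB int by (simp_all add: \<beta>_def)
  have I_eq: "- I_integrand f \<rho> \<rho>s \<theta> = w \<theta> + k' \<theta>" for \<theta>
  proof -
    have G: "f (\<rho>s \<theta> / \<rho> \<theta>) - \<rho>s \<theta> / \<rho> \<theta> * deriv f (\<rho>s \<theta> / \<rho> \<theta>) = - b - B' \<theta>"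
      using form[of "\<rho>s \<theta> / \<rho> \<theta>"] pos[of \<theta>]
      by (simp add: B'_def box_cox_primitive_def algebra_simps)
    show ?thesis
      unfolding I_integrand_def expect G unfolding deriv_ratio by (simp add: w_def k'_def algebra_simps)
  qed
  \<comment> \<open>The splitting applies to minus the integrand, which is the one bounded below;
    negating back gives \<open>I_integrand\<close> itself.\<close>
  note EI = ext_integral_nonneg_add[OF w_meas w_nonneg k'(1) I_eq]
  note EI' = ext_integral_uminus[OF EI(1)]
  have I_val: "I_functional f \<rho> \<rho>s
      = enn2ereal (\<integral>\<^sup>+ \<theta>. ennreal (w \<theta>) \<partial>lebesgue) + ereal (LINT \<theta>|lebesgue. k \<theta>)"
    using EI(2) EI'(2) by (simp add: I_functional_def k'(2))
  have "ereal c * (N2 + N1) = enn2ereal (ennreal c *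
      ((\<integral>\<^sup>+ \<theta>. ennreal (g1 \<theta>) \<partial>lebesgue) + (\<integral>\<^sup>+ \<theta>. ennreal (g2 \<theta>) \<partial>lebesgue)))"
    using \<open>0 \<le> c\<close> by (simp add: N1_def N2_def times_ennreal.rep_eq plus_ennreal.rep_eq enn2ereal_ennreal add.commute)
  also have "ennreal c * ((\<integral>\<^sup>+ \<theta>. ennreal (g1 \<theta>) \<partial>lebesgue) + (\<integral>\<^sup>+ \<theta>. ennreal (g2 \<theta>) \<partial>lebesgue))
      = (\<integral>\<^sup>+ \<theta>. ennreal (c * (g1 \<theta> + g2 \<theta>)) \<partial>lebesgue)"
    using g_nonneg \<open>0 \<le> c\<close> by (simp add: ennreal_mult nn_integral_cmult nn_integral_add)
  also have "enn2ereal \<dots> \<le> enn2ereal (\<integral>\<^sup>+ \<theta>. ennreal (w \<theta>) \<partial>lebesgue)"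
    using w_ge by (intro iffD1[OF less_eq_ennreal.rep_eq] nn_integral_mono ennreal_leI)
  also have "\<dots> \<le> I_functional f \<rho> \<rho>s"
    using k(2) unfolding I_val by (simp add: add_increasing2)
  finally have bound: "ereal c * (N2 + N1) \<le> I_functional f \<rho> \<rho>s" .
  have "0 \<le> ereal c * (N2 + N1)" using N_nonneg \<open>0 \<le> c\<close> by simp
  then have "0 \<le> I_functional f \<rho> \<rho>s" using bound by (rule order_trans)
  then have I_inf: "-\<infinity> < I_functional f \<rho> \<rho>s"
    by (rule less_le_trans[rotated]) simp
  have N_inf: "-\<infinity> < N1" "-\<infinity> < N2"
    by (rule less_le_trans[OF _ N_nonneg(1)], simp, rule less_le_trans[OF _ N_nonneg(2)], simp)
  show ?thesis
    using EI'(1) I_inf E1(1) E2(1) N_inf bound unfolding div1 div2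
    by (auto simp: c_def q_def one_ereal_def[symmetric] split: if_splits)
qed

end
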